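(* Let $r \geq 5$ and let $k$ be an integer with $0 \leq k \leq \frac{r-2}{3}$. Let $M$ be a simple binary matroid of rank $r$ with no coloops that has a $k$-loose element. Then $|E(M)| \leq 2^k(r-k+1)$.
   Context: For a matroid $M$ of rank $r$ and a non-negative integer $k$, an element $t$ of $M$ is called $k$-loose if every circuit of $M$ that contains $t$ has size greater than $r-k$. A binary matroid is one representable over $GF(2)$; a matroid is simple if it has no loops and no parallel pairs. *)

theory Defs
  imports Complex_Main "HOL-Library.Z2" "HOL-Library.Function_Algebras"
begin

locale matroid =
  fixes E :: "'a set" and \<I> :: "'a set set"
  assumes finite_ground: "finite E"
    and indep_subset_ground: "X \<in> \<I> \<Longrightarrow> X \<subseteq> E"
    and indep_empty: "{} \<in> \<I>"
    and indep_subset: "X \<in> \<I> \<Longrightarrow> Y \<subseteq> X \<Longrightarrow> Y \<in> \<I>"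
    and indep_augment: "X \<in> \<I> \<Longrightarrow> Y \<in> \<I> \<Longrightarrow> card X < card Y \<Longrightarrow>
           \<exists>e \<in> Y - X. insert e X \<in> \<I>"

definition matroid_rank :: "'a set set \<Rightarrow> nat" where
  "matroid_rank \<I> = Max (card ` \<I>)"

definition matroid_basis :: "'a set set \<Rightarrow> 'a set \<Rightarrow> bool" where
  "matroid_basis \<I> B \<longleftrightarrow> B \<in> \<I> \<and> (\<forall>X \<in> \<I>. B \<subseteq> X \<longrightarrow> X = B)"

definition matroid_circuit :: "'a set \<Rightarrow> 'a set set \<Rightarrow> 'a set \<Rightarrow> bool" where
  "matroid_circuit E \<I> C \<longleftrightarrow> C \<subseteq> E \<and> C \<notin> \<I> \<and> (\<forall>X. X \<subset> C \<longrightarrow> X \<in> \<I>)"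

definition matroid_loop :: "'a set \<Rightarrow> 'a set set \<Rightarrow> 'a \<Rightarrow> bool" where
  "matroid_loop E \<I> e \<longleftrightarrow> matroid_circuit E \<I> {e}"

definition matroid_parallel :: "'a set \<Rightarrow> 'a set set \<Rightarrow> 'a \<Rightarrow> 'a \<Rightarrow> bool" where
  "matroid_parallel E \<I> e f \<longleftrightarrow> e \<noteq> f \<and> matroid_circuit E \<I> {e, f}"

definition matroid_coloop :: "'a set \<Rightarrow> 'a set set \<Rightarrow> 'a \<Rightarrow> bool" where
  "matroid_coloop E \<I> e \<longleftrightarrow> e \<in> E \<and> (\<forall>B. matroid_basis \<I> B \<longrightarrow> e \<in> B)"

definition simple_matroid :: "'a set \<Rightarrow> 'a set set \<Rightarrow> bool" where
  "simple_matroid E \<I> \<longleftrightarrow> matroid E \<I> \<and> (\<nexists>e. matroid_loop E \<I> e) \<and>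
     (\<nexists>e f. matroid_parallel E \<I> e f)"

definition coord_scale :: "'f::field \<Rightarrow> (nat \<Rightarrow> 'f) \<Rightarrow> nat \<Rightarrow> 'f" where
  "coord_scale c v = (\<lambda>i. c * v i)"

lemma vector_space_coord_scale: "vector_space coord_scale"
  by unfold_locales (auto simp: coord_scale_def fun_eq_iff algebra_simps)

text \<open>
  A representation over the field \<open>'f\<close> assigns to each element a vector of \<open>'f\<^sup>m\<close>
  (encoded as a function on \<open>nat\<close> vanishing from \<open>m\<close> on). Injectivity is needed
  because linear independence in the library is a property of sets of vectors,
  whereas the columns of a representing matrix form a family.
\<close>
definition represents_matroid ::
    "nat \<Rightarrow> ('a \<Rightarrow> nat \<Rightarrow> 'f::field) \<Rightarrow> 'a set \<Rightarrow> 'a set set \<Rightarrow> bool" where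
  "represents_matroid m \<phi> E \<I> \<longleftrightarrow>
     (\<forall>e \<in> E. \<forall>i \<ge> m. \<phi> e i = 0) \<and>
     (\<forall>X. X \<subseteq> E \<longrightarrow>
        (X \<in> \<I> \<longleftrightarrow> inj_on \<phi> X \<and> module.independent coord_scale (\<phi> ` X)))"

definition binary_matroid :: "'a set \<Rightarrow> 'a set set \<Rightarrow> bool" where
  "binary_matroid E \<I> \<longleftrightarrow> matroid E \<I> \<and>
     (\<exists>m (\<phi> :: 'a \<Rightarrow> nat \<Rightarrow> bit). represents_matroid m \<phi> E \<I>)"

text \<open>The inequality is stated over the integers so that \<open>r - k\<close> is not truncated.\<close>
definition k_loose :: "'a set \<Rightarrow> 'a set set \<Rightarrow> nat \<Rightarrow> 'a \<Rightarrow> bool" where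
  "k_loose E \<I> k t \<longleftrightarrow> t \<in> E \<and>
     (\<forall>C. matroid_circuit E \<I> C \<and> t \<in> C \<longrightarrow>
        int (card C) > int (matroid_rank \<I>) - int k)"

end

theory Submission
  imports Defs
begin

text \<open>
  Identify the elements with vectors over \<open>GF(2)\<close> and let \<open>insert t D\<close> be a smallest circuit
  through \<open>t\<close>. Extend \<open>D\<close> to a basis \<open>D \<union> W\<close> and identify every vector with its support in
  this basis. If two vectors, each from the ground set without \<open>t\<close> or zero, have the same part
  in \<open>W\<close> and differ in a set \<open>S \<subseteq> D\<close>, then \<open>t\<close> is the sum of these two vectors and of \<open>D - S\<close>;
  by minimality \<open>card S \<le> 2\<close>. A family of subsets of \<open>D\<close> with pairwise symmetric differences of
  size at most 2 has at most \<open>card D + 1\<close> members, and there are \<open>2 ^ card W\<close> possible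
  parts in \<open>W\<close>.
\<close>

section \<open>Set families with symmetric differences of size at most 2\<close>

text \<open>Comparison with \<open>{}\<close> limits members to size 2, and any two pairs in
  \<open>G\<close> must meet. Pairwise meeting pairs form a star or a triangle. A triangle, like a
  star with an extra singleton off its centre, leaves room for only four sets, which is where
  \<open>card D \<ge> 3\<close> enters.\<close>

lemma card_sym_diff_le_2_normalized:
  assumes D: "finite D" "card D \<ge> 3"
    and sub: "\<And>P. P \<in> G \<Longrightarrow> P \<subseteq> D"
    and diam: "\<And>P Q. P \<in> G \<Longrightarrow> Q \<in> G \<Longrightarrow> card (sym_diff P Q) \<le> 2"
    and empty: "{} \<in> G"
  shows "card G \<le> card D + 1"
proof (cases "\<forall>P\<in>G. card P \<le> 1")
  case True
  have "G \<subseteq> insert {} ((\<lambda>x. {x}) ` D)"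
  proof
    fix P assume P: "P \<in> G"
    then have "finite P" using sub D finite_subset by blast
    moreover have "card P \<le> 1" using True P by blast
    ultimately have "P = {} \<or> (\<exists>x. P = {x})"
      by (metis One_nat_def card_0_eq card_1_singletonE le_SucE le_zero_eq)
    then show "P \<in> insert {} ((\<lambda>x. {x}) ` D)" using sub[OF P] by auto
  qed
  then have "card G \<le> card (insert {} ((\<lambda>x. {x}) ` D))"
    using D by (intro card_mono) auto
  also have "\<dots> \<le> Suc (card ((\<lambda>x. {x}) ` D))" by (rule card_insert_le_m1) auto
  also have "\<dots> \<le> Suc (card D)" using card_image_le D by auto
  finally show ?thesis by simp
next
  case False
  have le2: "card P \<le> 2" if "P \<in> G" for P using diam[OF that empty] by simp
  obtain P0 where P0: "P0 \<in> G" "card P0 = 2" using False le2 by force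
  then obtain a b where ab: "{a, b} \<in> G" "a \<noteq> b" by (auto simp: card_2_iff)
  have shapes: "Q = {} \<or> (\<exists>x. Q = {x}) \<or> (\<exists>x y. x \<noteq> y \<and> Q = {x, y})" if "Q \<in> G" for Q
  proof -
    have "finite Q" using sub D finite_subset that by blast
    moreover have "card Q = 0 \<or> card Q = 1 \<or> card Q = 2" using le2[OF that] by linarith
    ultimately show ?thesis by (auto simp: card_2_iff card_1_singleton_iff)
  qed
  have no3: "\<not> (x \<noteq> y \<and> x \<noteq> z \<and> y \<noteq> z \<and> {x, y, z} \<subseteq> sym_diff P Q)"
    if "P \<in> G" "Q \<in> G" for x y z P Q
  proof
    assume *: "x \<noteq> y \<and> x \<noteq> z \<and> y \<noteq> z \<and> {x, y, z} \<subseteq> sym_diff P Q"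
    have "sym_diff P Q \<subseteq> D" using sub[OF that(1)] sub[OF that(2)] by blast
    then have "finite (sym_diff P Q)" using D(1) by (rule finite_subset)
    then have "card {x, y, z} \<le> card (sym_diff P Q)" using * by (intro card_mono) blast+
    moreover have "card {x, y, z} = 3" using * by simp
    ultimately show False using diam[OF that] by linarith
  qed
  \<comment> \<open>A singleton outside a pair, or two disjoint pairs, would put three distinct
    points into one symmetric difference.\<close>
  have single: "x \<in> {p, q}" if "{x} \<in> G" "{p, q} \<in> G" "p \<noteq> q" for x p q
    using no3[OF that(1,2), of x p q] that(3) by auto
  have pairs: "p = u \<or> p = v \<or> q = u \<or> q = v" if "{p, q} \<in> G" "{u, v} \<in> G" "p \<noteq> q" "u \<noteq> v"
    for p q u v
    using no3[OF that(1,2), of p q u] that(3,4) by auto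
  \<comment> \<open>Here \<open>a\<close> is the centre of the star. Both are generalized because
    either end of the pair fixed above may turn out to be the centre.\<close>
  have star: "card G \<le> card D + 1"
    if ab: "{a, b} \<in> G" "a \<noteq> b" and all: "\<And>x y. {x, y} \<in> G \<Longrightarrow> x \<noteq> y \<Longrightarrow> a \<in> {x, y}" for a b
  proof (cases "{b} \<in> G")
    case True
    \<comment> \<open>Every pair contains \<open>b\<close> because of the singleton
      \<open>{b}\<close>, and \<open>a\<close> as the centre, so \<open>{a, b}\<close> is the only
      pair.\<close>
    have "G \<subseteq> {{}, {a}, {b}, {a, b}}"
    proof
      fix Q assume Q: "Q \<in> G"
      from shapes[OF Q] show "Q \<in> {{}, {a}, {b}, {a, b}}"
      proof (elim disjE exE conjE)
        fix x assume "Q = {x}" then show ?thesis using single[OF _ ab] Q by auto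
      next
        fix x y assume xy: "x \<noteq> y" "Q = {x, y}"
        then show ?thesis using all[of x y] single[OF True, of x y] Q ab(2) by auto
      qed auto
    qed
    then have "card G \<le> card {{}, {a}, {b}, {a, b}}" by (intro card_mono) auto
    also have "\<dots> \<le> 4" by (auto simp: card_insert_if)
    finally show ?thesis using D by simp
  next
    case False
    have aD: "a \<in> D" using sub ab by auto
    \<comment> \<open>The value \<open>x = a\<close> yields the singleton \<open>{a}\<close>, so one
      image indexed by \<open>D\<close> covers singletons and pairs.\<close>
    have "G \<subseteq> insert {} ((\<lambda>x. {a, x}) ` D)"
    proof
      fix Q assume Q: "Q \<in> G"
      from shapes[OF Q] show "Q \<in> insert {} ((\<lambda>x. {a, x}) ` D)"
      proof (elim disjE exE conjE)
        fix x assume x: "Q = {x}"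
        then have "x = a" using single[OF _ ab] Q False by auto
        then show ?thesis using x aD by auto
      next
        fix x y assume xy: "x \<noteq> y" "Q = {x, y}"
        then have "a \<in> {x, y}" using all Q by blast
        then have "Q = {a, x} \<or> Q = {a, y}" using xy by auto
        then show ?thesis using sub[OF Q] xy by auto
      qed auto
    qed
    then have "card G \<le> card (insert {} ((\<lambda>x. {a, x}) ` D))"
      using D by (intro card_mono) auto
    also have "\<dots> \<le> Suc (card ((\<lambda>x. {a, x}) ` D))" by (rule card_insert_le_m1) auto
    also have "\<dots> \<le> Suc (card D)" using card_image_le D by auto
    finally show ?thesis by simp
  qed
  have norm: "\<exists>c. Q = {b, c} \<and> c \<noteq> b" if "Q = {x, y}" "x \<noteq> y" "b \<in> Q" for Q x y and b :: 'a
    using that by auto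
  show ?thesis
  proof (cases "(\<forall>x y. {x, y} \<in> G \<longrightarrow> x \<noteq> y \<longrightarrow> a \<in> {x, y}) \<or>
      (\<forall>x y. {x, y} \<in> G \<longrightarrow> x \<noteq> y \<longrightarrow> b \<in> {x, y})")
    case True
    then show ?thesis
    proof
      assume "\<forall>x y. {x, y} \<in> G \<longrightarrow> x \<noteq> y \<longrightarrow> a \<in> {x, y}"
      then show ?thesis using star[of a b] ab by blast
    next
      assume "\<forall>x y. {x, y} \<in> G \<longrightarrow> x \<noteq> y \<longrightarrow> b \<in> {x, y}"
      then show ?thesis using star[of b a] ab by (metis insert_commute)
    qed
  next
    case no_star: False
    \<comment> \<open>A pair avoiding \<open>a\<close> still meets \<open>{a, b}\<close>, so it
      contains \<open>b\<close>; likewise the one avoiding \<open>b\<close> contains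
      \<open>a\<close>. These two meet in a third point \<open>c\<close>, which closes a
      triangle.\<close>
    then obtain p q u v where
      pq: "{p, q} \<in> G" "p \<noteq> q" "a \<notin> {p, q}" and uv: "{u, v} \<in> G" "u \<noteq> v" "b \<notin> {u, v}"
      by blast
    have "b \<in> {p, q}" using pairs[OF ab(1) pq(1)] ab pq by auto
    then obtain c where c: "{p, q} = {b, c}" "c \<noteq> b" using norm[of "{p, q}" p q b] pq by blast
    have "a \<in> {u, v}" using pairs[OF ab(1) uv(1)] ab uv by auto
    then obtain e where e: "{u, v} = {a, e}" "e \<noteq> a" using norm[of "{u, v}" u v a] uv by blast
    have bc: "{b, c} \<in> G" "b \<noteq> c" "c \<noteq> a" using pq c by auto
    have ae: "{a, e} \<in> G" "e \<noteq> a" "e \<noteq> b" using uv e by auto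
    have "e = c" using pairs[OF bc(1) ae(1)] bc ae ab by auto
    then have ac: "{a, c} \<in> G" using ae by simp
    \<comment> \<open>No point lies in all three sides, which excludes singletons, and a pair
      meeting all three sides is itself a side.\<close>
    have "G \<subseteq> {{}, {a, b}, {a, c}, {b, c}}"
    proof
      fix Q assume Q: "Q \<in> G"
      from shapes[OF Q] show "Q \<in> {{}, {a, b}, {a, c}, {b, c}}"
      proof (elim disjE exE conjE)
        fix x assume "Q = {x}"
        then show ?thesis
          using single[OF _ ab] single[OF _ bc(1,2)] single[OF _ ac] bc ab Q by auto
      next
        fix x y assume xy: "x \<noteq> y" "Q = {x, y}"
        then have xyG: "{x, y} \<in> G" using Q by simp
        show ?thesis
          using pairs[OF xyG ab(1)] pairs[OF xyG bc(1)] pairs[OF xyG ac] xy ab(2) bc(2,3) by auto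
      qed auto
    qed
    then have "card G \<le> card {{}, {a, b}, {a, c}, {b, c}}" by (intro card_mono) auto
    also have "\<dots> \<le> 4" by (auto simp: card_insert_if)
    finally show ?thesis using D by simp
  qed
qed

lemma sym_diff_translate: "sym_diff (sym_diff P R) (sym_diff Q R) = sym_diff P Q"
  by auto

text \<open>Translation by a fixed member \<open>R\<close> preserves symmetric differences and sends
  \<open>R\<close> to \<open>{}\<close>. The members themselves may reach outside \<open>D\<close>;
  only their differences lie in it.\<close>

lemma card_sym_diff_le_2:
  assumes D: "finite D" "card D \<ge> 3"
    and sub: "\<And>P Q. P \<in> G \<Longrightarrow> Q \<in> G \<Longrightarrow> sym_diff P Q \<subseteq> D"
    and diam: "\<And>P Q. P \<in> G \<Longrightarrow> Q \<in> G \<Longrightarrow> card (sym_diff P Q) \<le> 2"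
  shows "card G \<le> card D + 1"
proof (cases "G = {}")
  case False
  then obtain R where R: "R \<in> G" by blast
  have "inj_on (\<lambda>P. sym_diff P R) G" by (rule inj_onI) blast
  then have "card G = card ((\<lambda>P. sym_diff P R) ` G)" by (simp add: card_image)
  also have "\<dots> \<le> card D + 1"
  proof (rule card_sym_diff_le_2_normalized[OF D])
    show "{} \<in> (\<lambda>P. sym_diff P R) ` G" using R by (intro image_eqI[where x=R]) auto
  next
    fix P assume "P \<in> (\<lambda>P. sym_diff P R) ` G"
    then show "P \<subseteq> D" using sub R by blast
  next
    fix P Q assume "P \<in> (\<lambda>P. sym_diff P R) ` G" "Q \<in> (\<lambda>P. sym_diff P R) ` G"
    then obtain P' Q' where PQ: "P' \<in> G" "Q' \<in> G" "P = sym_diff P' R" "Q = sym_diff Q' R"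
      by (elim imageE)
    show "card (sym_diff P Q) \<le> 2"
      unfolding PQ(3,4) sym_diff_translate using PQ(1,2) by (rule diam)
  qed
  finally show ?thesis .
qed simp

lemma card_le_sum_fibres:
  assumes W: "finite W" and F: "finite F"
    and fib: "\<And>U. U \<subseteq> W \<Longrightarrow> card {P \<in> F. P \<inter> W = U} \<le> n"
  shows "card F \<le> 2 ^ card W * n"
proof -
  have "card F \<le> card (\<Union>U\<in>Pow W. {P \<in> F. P \<inter> W = U})"
  proof (rule card_mono)
    show "finite (\<Union>U\<in>Pow W. {P \<in> F. P \<inter> W = U})"
      using F by (rule rev_finite_subset) blast
    show "F \<subseteq> (\<Union>U\<in>Pow W. {P \<in> F. P \<inter> W = U})"
    proof
      fix P assume "P \<in> F"
      then show "P \<in> (\<Union>U\<in>Pow W. {P \<in> F. P \<inter> W = U})"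
        by (intro UN_I[of "P \<inter> W"]) simp_all
    qed
  qed
  also have "\<dots> \<le> (\<Sum>U\<in>Pow W. card {P \<in> F. P \<inter> W = U})"
    by (rule card_UN_le) (simp add: W)
  also have "\<dots> \<le> card (Pow W) * n"
    using sum_bounded_above[of "Pow W" "\<lambda>U. card {P \<in> F. P \<inter> W = U}" n] fib by simp
  finally show ?thesis using W by (simp add: card_Pow)
qed

section \<open>Vectors over GF(2) and independence through zero sums\<close>

lemma bit_fun_add_self: "v + v = 0" for v :: "nat \<Rightarrow> bit"
  by (auto simp: fun_eq_iff)

lemma bit_fun_add_eq_0_iff: "v + w = 0 \<longleftrightarrow> v = w" for v w :: "nat \<Rightarrow> bit"
  by (metis add.assoc add.left_neutral add.right_neutral bit_fun_add_self)

text \<open>The common part \<open>P \<inter> Q\<close> is counted twice and cancels in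
  characteristic 2.\<close>

lemma sum_sym_diff:
  fixes f :: "'a \<Rightarrow> nat \<Rightarrow> bit"
  assumes "finite P" "finite Q"
  shows "sum f (sym_diff P Q) = sum f P + sum f Q"
proof -
  have "sum f P = sum f (P - Q) + sum f (P \<inter> Q)"
    using assms by (metis sum.Int_Diff add.commute)
  moreover have "sum f Q = sum f (Q - P) + sum f (P \<inter> Q)"
    using assms by (metis sum.Int_Diff add.commute Int_commute)
  moreover have "sum f (sym_diff P Q) = sum f (P - Q) + sum f (Q - P)"
    using assms by (intro sum.union_disjoint) auto
  ultimately show ?thesis
    using bit_fun_add_self[of "sum f (P \<inter> Q)"] by (simp add: algebra_simps)
qed

text \<open>Over GF(2) a linear combination is the sum over the set of nonzero coefficients. A
  failure of injectivity appears as a two-element zero sum, so a single condition on subsets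
  replaces both halves of the definition.\<close>

lemma represents_indep_iff:
  fixes \<phi> :: "'a \<Rightarrow> nat \<Rightarrow> bit"
  assumes rep: "represents_matroid m \<phi> E \<I>" and X: "X \<subseteq> E" "finite X"
  shows "X \<in> \<I> \<longleftrightarrow> (\<forall>Y. Y \<subseteq> X \<and> sum \<phi> Y = 0 \<longrightarrow> Y = {})"
proof -
  interpret vs: vector_space "coord_scale :: bit \<Rightarrow> _" by (rule vector_space_coord_scale)
  have iff: "X \<in> \<I> \<longleftrightarrow> inj_on \<phi> X \<and> \<not> vs.dependent (\<phi> ` X)"
    using rep X unfolding represents_matroid_def by blast
  have dep: "vs.dependent (\<phi> ` X) \<longleftrightarrow>
      (\<exists>u. (\<exists>v\<in>\<phi> ` X. u v \<noteq> 0) \<and> (\<Sum>v\<in>\<phi> ` X. coord_scale (u v) v) = 0)"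
    using X by (intro vs.dependent_finite) auto
  show ?thesis
  proof
    assume I: "X \<in> \<I>"
    then have inj: "inj_on \<phi> X" and ind: "\<not> vs.dependent (\<phi> ` X)" using iff by auto
    show "\<forall>Y. Y \<subseteq> X \<and> sum \<phi> Y = 0 \<longrightarrow> Y = {}"
    proof (intro allI impI, rule ccontr)
      fix Y assume Y: "Y \<subseteq> X \<and> sum \<phi> Y = 0" "Y \<noteq> {}"
      let ?u = "\<lambda>v. if v \<in> \<phi> ` Y then 1 else 0 :: bit"
      have "(\<Sum>v\<in>\<phi> ` X. coord_scale (?u v) v) = (\<Sum>v\<in>\<phi> ` Y. v)"
        using X Y by (intro sum.mono_neutral_cong_right) (auto simp: coord_scale_def fun_eq_iff)
      also have "\<dots> = sum \<phi> Y"
        using inj Y by (simp add: sum.reindex inj_on_subset)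
      finally have "(\<Sum>v\<in>\<phi> ` X. coord_scale (?u v) v) = 0" using Y by simp
      moreover have "\<exists>v\<in>\<phi> ` X. ?u v \<noteq> 0" using Y by auto
      ultimately have "vs.dependent (\<phi> ` X)" unfolding dep by (intro exI[of _ ?u] conjI)
      then show False using ind by contradiction
    qed
  next
    assume R: "\<forall>Y. Y \<subseteq> X \<and> sum \<phi> Y = 0 \<longrightarrow> Y = {}"
    have inj: "inj_on \<phi> X"
    proof (rule inj_onI, rule ccontr)
      fix x y assume "x \<in> X" "y \<in> X" "\<phi> x = \<phi> y" "x \<noteq> y"
      then show False using R[rule_format, of "{x, y}"] bit_fun_add_self by auto
    qed
    moreover have "\<not> vs.dependent (\<phi> ` X)"
    proof
      assume "vs.dependent (\<phi> ` X)"
      then obtain u where u: "\<exists>v\<in>\<phi> ` X. u v \<noteq> 0" "(\<Sum>v\<in>\<phi> ` X. coord_scale (u v) v) = 0"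
        using dep by blast
      let ?Y = "{x \<in> X. u (\<phi> x) \<noteq> 0}"
      have "sum \<phi> ?Y = (\<Sum>x\<in>X. coord_scale (u (\<phi> x)) (\<phi> x))"
        using X by (intro sum.mono_neutral_cong_left) (auto simp: coord_scale_def fun_eq_iff)
      also have "\<dots> = (\<Sum>v\<in>\<phi> ` X. coord_scale (u v) v)"
        using inj by (simp add: sum.reindex)
      finally have "sum \<phi> ?Y = 0" using u(2) by (rule trans)
      moreover have "?Y \<subseteq> X" by (rule Collect_subset)
      ultimately have "?Y = {}" by (intro R[rule_format] conjI)
      then show False using u(1) by auto
    qed
    ultimately show "X \<in> \<I>" using iff by blast
  qed
qed

section \<open>Circuits and expansions in a represented binary matroid\<close>

locale binary_representation = matroid E \<I> for E :: "'a set" and \<I> +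
  fixes \<phi> :: "'a \<Rightarrow> nat \<Rightarrow> bit"
  assumes indep_iff: "X \<subseteq> E \<Longrightarrow> X \<in> \<I> \<longleftrightarrow> (\<forall>Y. Y \<subseteq> X \<and> sum \<phi> Y = 0 \<longrightarrow> Y = {})"
begin

lemma finite_subset_ground: "X \<subseteq> E \<Longrightarrow> finite X"
  using finite_ground finite_subset by blast

lemma finite_indep_sets: "finite \<I>"
  using finite_ground indep_subset_ground by (metis finite_Pow_iff finite_subset PowI subsetI)

lemma card_le_rank: "X \<in> \<I> \<Longrightarrow> card X \<le> matroid_rank \<I>"
  unfolding matroid_rank_def using finite_indep_sets by auto

lemma ex_indep_card_rank: "\<exists>X\<in>\<I>. card X = matroid_rank \<I>"
proof -
  have "Max (card ` \<I>) \<in> card ` \<I>" using finite_indep_sets indep_empty by (intro Max_in) auto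
  then show ?thesis unfolding matroid_rank_def by auto
qed

lemma extend_to_rank:
  assumes "X \<in> \<I>"
  shows "\<exists>B\<in>\<I>. X \<subseteq> B \<and> card B = matroid_rank \<I>"
  using assms
proof (induction "matroid_rank \<I> - card X" arbitrary: X)
  case 0
  then show ?case using card_le_rank[of X] by auto
next
  case (Suc n)
  obtain Y where Y: "Y \<in> \<I>" "card Y = matroid_rank \<I>" using ex_indep_card_rank by blast
  then obtain e where e: "e \<in> Y - X" "insert e X \<in> \<I>"
    using indep_augment[OF \<open>X \<in> \<I>\<close>, of Y] Suc.hyps(2) by (metis zero_less_Suc zero_less_diff)
  have "finite X" using Suc.prems indep_subset_ground finite_subset_ground by blast
  then have "n = matroid_rank \<I> - card (insert e X)" using Suc.hyps(2) e by auto
  from Suc.hyps(1)[OF this e(2)] show ?case by blast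
qed

text \<open>A nonempty zero-sum subset of \<open>insert e B\<close> must contain \<open>e\<close>,
  since \<open>B\<close> is independent; its other elements sum to \<open>\<phi> e\<close>.\<close>

lemma expansion_exists:
  assumes B: "B \<in> \<I>" and e: "e \<in> E" "e \<notin> B" and dep: "insert e B \<notin> \<I>"
  shows "\<exists>P\<subseteq>B. \<phi> e = sum \<phi> P"
proof -
  have BE: "B \<subseteq> E" using B indep_subset_ground by blast
  obtain Y where Y: "Y \<subseteq> insert e B" "sum \<phi> Y = 0" "Y \<noteq> {}"
    using indep_iff[of "insert e B"] dep BE e by auto
  have "e \<in> Y" using indep_iff[OF BE] B Y by blast
  moreover have "finite Y" using Y BE e finite_subset_ground by (meson finite_insert finite_subset)
  ultimately have "\<phi> e + sum \<phi> (Y - {e}) = 0" using Y sum.remove[of Y e \<phi>] by simp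
  then have "\<phi> e = sum \<phi> (Y - {e})" by (simp add: bit_fun_add_eq_0_iff)
  then show ?thesis using Y by blast
qed

text \<open>If a proper subset of \<open>Z\<close> contained a nonempty zero-sum set
  \<open>Y\<close>, then \<open>Y\<close> or \<open>Z - Y\<close> would be a smaller zero-sum set
  through \<open>t\<close>.\<close>

lemma min_zero_sum_circuit:
  assumes Z: "Z \<subseteq> E" "t \<in> Z" "sum \<phi> Z = 0"
    and min: "\<And>Y. Y \<subseteq> E \<Longrightarrow> t \<in> Y \<Longrightarrow> sum \<phi> Y = 0 \<Longrightarrow> card Z \<le> card Y"
  shows "matroid_circuit E \<I> Z"
  unfolding matroid_circuit_def
proof (intro conjI allI impI)
  show "Z \<subseteq> E" by fact
  show "Z \<notin> \<I>" using indep_iff[OF Z(1)] Z by blast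
  have finZ: "finite Z" using Z finite_subset_ground by blast
  fix X assume X: "X \<subset> Z"
  have "Y = {}" if Y: "Y \<subseteq> X" "sum \<phi> Y = 0" for Y
  proof (rule ccontr)
    assume "Y \<noteq> {}"
    show False
    proof (cases "t \<in> Y")
      case True
      then have "card Z \<le> card Y" using Y X Z min[of Y] by blast
      moreover have "card Y < card Z" using Y X finZ by (intro psubset_card_mono) auto
      ultimately show False by simp
    next
      case False
      have "sum \<phi> Z = sum \<phi> (Z - Y) + sum \<phi> Y"
        using Y X finZ by (intro sum.subset_diff) auto
      then have "sum \<phi> (Z - Y) = 0" using Z Y by simp
      then have "card Z \<le> card (Z - Y)" using False Z min[of "Z - Y"] by blast
      moreover have "card (Z - Y) < card Z"
        using Y X finZ \<open>Y \<noteq> {}\<close> by (intro psubset_card_mono) auto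
      ultimately show False by simp
    qed
  qed
  then show "X \<in> \<I>" using indep_iff[of X] X Z by blast
qed

text \<open>A zero vector would give a loop, and two equal vectors a parallel pair.\<close>

lemma inj_on_representation:
  assumes "simple_matroid E \<I>"
  shows "inj_on \<phi> E" and "e \<in> E \<Longrightarrow> \<phi> e \<noteq> 0"
proof -
  have single: "{e} \<in> \<I>" if "e \<in> E" for e
  proof (rule ccontr)
    assume "{e} \<notin> \<I>"
    then have "matroid_loop E \<I> e"
      unfolding matroid_loop_def matroid_circuit_def using that indep_empty
      by (auto simp: psubset_eq subset_singleton_iff)
    then show False using assms unfolding simple_matroid_def by blast
  qed
  show "\<phi> e \<noteq> 0" if "e \<in> E"
  proof
    assume "\<phi> e = 0"
    then have "sum \<phi> {e} = 0" by simp
    then have "{e} \<notin> \<I>" using indep_iff[of "{e}"] that by blast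
    then show False using single[OF that] by contradiction
  qed
  show "inj_on \<phi> E"
  proof (rule inj_onI, rule ccontr)
    fix e f assume ef: "e \<in> E" "f \<in> E" "\<phi> e = \<phi> f" "e \<noteq> f"
    then have "sum \<phi> {e, f} = 0" using bit_fun_add_self by simp
    then have "{e, f} \<notin> \<I>" using indep_iff[of "{e, f}"] ef by blast
    moreover have "X \<in> \<I>" if "X \<subset> {e, f}" for X
    proof -
      have "X \<subseteq> {e} \<or> X \<subseteq> {f}" using that by auto
      then show ?thesis using single ef indep_subset by blast
    qed
    ultimately have "matroid_parallel E \<I> e f"
      unfolding matroid_parallel_def matroid_circuit_def using ef by auto
    then show False using assms unfolding simple_matroid_def by blast
  qed
qed

section \<open>The bound on the ground set\<close>

lemma ground_card_bound:
  assumes simple: "simple_matroid E \<I>"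
    and ncl: "\<not> matroid_coloop E \<I> t" and loose: "k_loose E \<I> k t"
    and big: "k + 3 \<le> matroid_rank \<I>"
  shows "card E \<le> 2 ^ k * (matroid_rank \<I> - k + 1)"
proof -
  let ?r = "matroid_rank \<I>"
  have tE: "t \<in> E" using loose unfolding k_loose_def by blast
  \<comment> \<open>A basis avoiding \<open>t\<close> exists because \<open>t\<close> is no coloop;
    expanding \<open>t\<close> in it gives a zero-sum set through \<open>t\<close>, so there is
    something to minimize over.\<close>
  obtain B0 where B0: "B0 \<in> \<I>" "t \<notin> B0" "\<forall>X\<in>\<I>. B0 \<subseteq> X \<longrightarrow> X = B0"
    using ncl tE unfolding matroid_coloop_def matroid_basis_def by blast
  then have "insert t B0 \<notin> \<I>" by blast
  from expansion_exists[OF B0(1) tE B0(2) this]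
  obtain P0 where P0: "P0 \<subseteq> B0" "\<phi> t = sum \<phi> P0" by blast
  \<comment> \<open>Minimizing over zero-sum sets instead of circuits lets later competitors of
    \<open>Z\<close> be arbitrary zero-sum sets through \<open>t\<close>.\<close>
  define zs where "zs Y \<longleftrightarrow> Y \<subseteq> E \<and> t \<in> Y \<and> sum \<phi> Y = 0" for Y
  have P0E: "P0 \<subseteq> E" using P0 B0 indep_subset_ground by blast
  then have "zs (insert t P0)"
    unfolding zs_def using P0 B0 tE finite_subset_ground[OF P0E] bit_fun_add_self
    by (subst sum.insert) auto
  then obtain Z where Z: "zs Z" and min: "\<And>Y. zs Y \<Longrightarrow> card Z \<le> card Y"
    using ex_has_least_nat[of zs "insert t P0" card] by blast
  have circ: "matroid_circuit E \<I> Z"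
    using Z min unfolding zs_def by (intro min_zero_sum_circuit[of Z t]) auto
  have finZ: "finite Z" using Z finite_subset_ground unfolding zs_def by blast
  define D where "D = Z - {t}"
  have tD: "t \<notin> D" and finD: "finite D" and DE: "D \<subseteq> E"
    using Z finZ unfolding D_def zs_def by auto
  have cardZ: "card Z = card D + 1"
    using Z card.remove[OF finZ, of t] unfolding D_def zs_def by simp
  \<comment> \<open>The strict inequality in looseness absorbs the element \<open>t\<close> that
    \<open>Z\<close> has beyond \<open>D\<close>.\<close>
  have cardD: "?r \<le> k + card D"
    using loose circ Z cardZ unfolding k_loose_def zs_def by force
  have sumD: "\<phi> t = sum \<phi> D"
    using Z sum.remove[OF finZ, of t \<phi>] unfolding zs_def D_def
    by (simp add: bit_fun_add_eq_0_iff)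
  have DI: "D \<in> \<I>" using circ Z unfolding matroid_circuit_def D_def zs_def by blast
  obtain B where B: "B \<in> \<I>" "D \<subseteq> B" "card B = ?r" using extend_to_rank[OF DI] by blast
  have BE: "B \<subseteq> E" and finB: "finite B" using B indep_subset_ground finite_subset_ground by blast+
  define W where "W = B - D"
  have finW: "finite W" using finB unfolding W_def by simp
  have cardW: "card D + card W = ?r"
    using B finD card_mono[OF finB B(2)] unfolding W_def by (simp add: card_Diff_subset)
  have "\<exists>P\<subseteq>B. \<phi> e = sum \<phi> P" if e: "e \<in> E" for e
  proof (cases "e \<in> B")
    case True
    then show ?thesis by (intro exI[of _ "{e}"]) auto
  next
    case False
    have "insert e B \<notin> \<I>" using card_le_rank[of "insert e B"] False finB B by auto
    then show ?thesis using expansion_exists[OF B(1) e False] by blast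
  qed
  then obtain supp where supp: "\<And>e. e \<in> E \<Longrightarrow> supp e \<subseteq> B \<and> \<phi> e = sum \<phi> (supp e)" by metis
  \<comment> \<open>The set \<open>{}\<close> is the support of the zero vector. It is not the
    support of any element, so it makes up for the removed \<open>t\<close> and
    \<open>card F = card E\<close>.\<close>
  define F where "F = insert {} (supp ` (E - {t}))"
  have inj: "inj_on supp (E - {t})"
    using inj_on_representation(1)[OF simple] supp by (intro inj_onI) (metis DiffD1 inj_onD)
  have "{} \<notin> supp ` (E - {t})"
    using inj_on_representation(2)[OF simple] supp by (metis DiffD1 imageE sum.empty)
  then have "card F = Suc (card (E - {t}))"
    unfolding F_def using card_image[OF inj] finite_ground by (simp del: card_Diff_singleton)
  then have cardF: "card F = card E" using card.remove[OF finite_ground tE] by simp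
  have finF: "finite F" unfolding F_def using finite_ground by auto
  have FB: "P \<subseteq> B" if "P \<in> F" for P using that supp unfolding F_def by auto
  have lift: "\<exists>T. T \<subseteq> E \<and> t \<notin> T \<and> card T \<le> 1 \<and> sum \<phi> T = sum \<phi> P" if "P \<in> F" for P
  proof (cases "P = {}")
    case True
    then show ?thesis by (intro exI[of _ "{}"]) auto
  next
    case False
    then obtain e where "e \<in> E - {t}" "P = supp e" using \<open>P \<in> F\<close> unfolding F_def by blast
    then show ?thesis using supp[of e] by (intro exI[of _ "{e}"]) auto
  qed
  have diam: "card (sym_diff P Q) \<le> 2"
    if P: "P \<in> F" and Q: "Q \<in> F" and sub: "sym_diff P Q \<subseteq> D" for P Q
  proof -
    obtain T where T: "T \<subseteq> E" "t \<notin> T" "card T \<le> 1" "sum \<phi> T = sum \<phi> P" using lift[OF P] by blast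
    obtain S where S: "S \<subseteq> E" "t \<notin> S" "card S \<le> 1" "sum \<phi> S = sum \<phi> Q" using lift[OF Q] by blast
    \<comment> \<open>The elements behind \<open>P\<close> and \<open>Q\<close> together sum to the
      sum over \<open>sym_diff P Q\<close>; adding the rest of \<open>D\<close> gives
      \<open>\<phi> t\<close>. Symmetric differences are taken because \<open>T\<close>,
      \<open>S\<close> and \<open>?R\<close> may overlap. Hence \<open>insert t ?Y\<close> competes
      with \<open>Z\<close>.\<close>
    let ?R = "D - sym_diff P Q"
    let ?TS = "sym_diff T S"
    let ?Y = "sym_diff ?TS ?R"
    have fin: "finite T" "finite S" "finite P" "finite Q"
      using finite_subset_ground[OF T(1)] finite_subset_ground[OF S(1)]
        finite_subset[OF FB[OF P] finB] finite_subset[OF FB[OF Q] finB] .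
    have "sum \<phi> D = sum \<phi> ?R + sum \<phi> (sym_diff P Q)"
      using sub finD by (intro sum.subset_diff) auto
    moreover have "sum \<phi> ?Y = sum \<phi> ?TS + sum \<phi> ?R"
      using fin finD by (intro sum_sym_diff) auto
    moreover have "sum \<phi> ?TS = sum \<phi> (sym_diff P Q)"
      by (simp only: sum_sym_diff[OF fin(1,2)] sum_sym_diff[OF fin(3,4)] T(4) S(4))
    ultimately have "sum \<phi> ?Y = \<phi> t" using sumD by (simp add: add.commute)
    moreover have tY: "t \<notin> ?Y" using T(2) S(2) tD by blast
    moreover have finY: "finite ?Y" using fin finD by auto
    ultimately have "sum \<phi> (insert t ?Y) = 0" using bit_fun_add_self by (subst sum.insert) auto
    moreover have "insert t ?Y \<subseteq> E" using tE T(1) S(1) DE by blast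
    ultimately have "zs (insert t ?Y)" unfolding zs_def by simp
    then have "card Z \<le> card (insert t ?Y)" by (rule min)
    then have "card D \<le> card ?Y" using cardZ tY finY by simp
    also have "\<dots> \<le> card (T \<union> S \<union> ?R)" using fin finD by (intro card_mono) auto
    also have "\<dots> \<le> card T + card S + card ?R"
      using card_Un_le[of "T \<union> S" ?R] card_Un_le[of T S] by linarith
    also have "card ?R = card D - card (sym_diff P Q)"
      using sub fin by (intro card_Diff_subset) auto
    finally have "card D \<le> 2 + (card D - card (sym_diff P Q))" using T S by linarith
    \<comment> \<open>This keeps the subtraction of natural numbers from being truncated.\<close>
    moreover have "card (sym_diff P Q) \<le> card D" using sub finD by (rule card_mono[rotated])
    ultimately show ?thesis by linarith
  qed
  have D3: "card D \<ge> 3" using cardD big by linarith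
  have "card F \<le> 2 ^ card W * (card D + 1)"
  proof (rule card_le_sum_fibres[OF finW finF])
    fix U
    \<comment> \<open>All supports lie in \<open>B\<close>, the union of \<open>D\<close> and
      \<open>W\<close>, so equal traces on \<open>W\<close> leave differences only inside
      \<open>D\<close>.\<close>
    have sub: "sym_diff P Q \<subseteq> D" if "P \<in> {P \<in> F. P \<inter> W = U}" "Q \<in> {P \<in> F. P \<inter> W = U}" for P Q
      using that FB[of P] FB[of Q] unfolding W_def by blast
    then show "card {P \<in> F. P \<inter> W = U} \<le> card D + 1"
      by (intro card_sym_diff_le_2[OF finD D3]) (use diam in auto)
  qed
  also have "\<dots> \<le> 2 ^ k * (?r - k + 1)"
  proof -
    \<comment> \<open>The slack \<open>j\<close> measures how far \<open>card D\<close> exceeds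
      \<open>?r - k\<close>. Each unit of it adds one to the factor \<open>card D + 1\<close> but
      costs a factor 2 in \<open>2 ^ card W\<close>, so \<open>j = 0\<close> is the worst
      case.\<close>
    obtain j where j: "k = card W + j" using cardD cardW le_Suc_ex[of "card W" k] by auto
    have "card D + 1 = ?r - k + 1 + j" using j cardW big by linarith
    also have "\<dots> \<le> 2 ^ j * (?r - k + 1)"
    proof -
      have "j + 1 \<le> (2::nat) ^ j" by (induction j) auto
      then have "(j + 1) * (?r - k + 1) \<le> 2 ^ j * (?r - k + 1)" by (rule mult_le_mono1)
      moreover have "n + 1 + j \<le> (j + 1) * (n + 1)" for n :: nat by simp
      ultimately show ?thesis using le_trans by blast
    qed
    finally have "2 ^ card W * (card D + 1) \<le> 2 ^ card W * (2 ^ j * (?r - k + 1))"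
      by (rule mult_le_mono2)
    also have "\<dots> = 2 ^ k * (?r - k + 1)" unfolding j power_add by (rule mult.assoc[symmetric])
    finally show ?thesis .
  qed
  finally show ?thesis using cardF by simp
qed

end

theorem theorem1p1:
  fixes E :: "'a set" and \<I> :: "'a set set" and r k :: nat
  assumes "r \<ge> 5"
    and "real k \<le> (real r - 2) / 3"
    and "matroid E \<I>"
    and "simple_matroid E \<I>"
    and "binary_matroid E \<I>"
    and "matroid_rank \<I> = r"
    and "\<nexists>e. matroid_coloop E \<I> e"
    and "\<exists>t. k_loose E \<I> k t"
  shows "card E \<le> 2 ^ k * (r - k + 1)"
proof -
  obtain m and \<phi> :: "'a \<Rightarrow> nat \<Rightarrow> bit" where rep: "represents_matroid m \<phi> E \<I>"
    using assms(5) unfolding binary_matroid_def by blast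
  interpret matroid E \<I> by fact
  interpret binary_representation E \<I> \<phi>
    using represents_indep_iff[OF rep] finite_ground finite_subset by unfold_locales blast
  have "real (3 * k + 2) \<le> real r" using assms(2) by simp
  then have "3 * k + 2 \<le> r" by (simp only: of_nat_le_iff)
  \<comment> \<open>For \<open>k = 0\<close> this comes from \<open>r \<ge> 5\<close>, for positive
    \<open>k\<close> from \<open>3 * k + 2 \<le> r\<close>.\<close>
  then have "k + 3 \<le> matroid_rank \<I>" using assms(1,6) by linarith
  then show ?thesis using ground_card_bound assms by blast
qed

end
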